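(* Let $X$ be a real Banach space, let $f:X\to\mathbb{R}$ be locally Lipschitz continuous and let $0\notin\partial f(x)$ for some $x\in X$. Then there exist $\varepsilon>0$ and $h\in X$ with $\|h\|=1$ such that $$-\|a\|\le\langle a,h\rangle\le f^0(A;h)<0\quad\text{for all nonempty } A\subset B_\varepsilon(x)\text{ and all } a\in\partial f(A).$$
   Context: $X^*$ is the dual of $X$, $\langle\cdot,\cdot\rangle$ the duality pairing, and $B_\varepsilon(x)$ the open ball of radius $\varepsilon$ about $x$. For $f$ Lipschitz near $x$, Clarke's generalized directional derivative is $f^0(x;h)=\limsup_{y\to x,\,t\downarrow 0}\frac{f(y+th)-f(y)}{t}$ and Clarke's generalized gradient is $\partial f(x)=\{a\in X^*\mid\langle a,h\rangle\le f^0(x;h)\ \forall h\in X\}$. For nonempty $A\subset X$, the gradient of $f$ on $A$ is $\partial f(A):=\overline{\operatorname{conv}}^*\bigcup_{y\in A}\partial f(y)$ (the weak$^*$ closure of the convex hull), and the directional derivative of $f$ on $A$ in direction $h\in X$ is $f^0(A;h):=\sup_{y\in A}f^0(y;h)$. *)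

theory Defs
  imports "HOL-Analysis.Analysis"
begin

definition locally_lipschitz :: "('a::metric_space \<Rightarrow> 'b::metric_space) \<Rightarrow> bool" where
  "locally_lipschitz f \<longleftrightarrow> (\<forall>x. \<exists>e>0. \<exists>L. L-lipschitz_on (ball x e) f)"

text \<open>The upper limit is taken over \<open>(y, t)\<close> jointly, and \<open>y = x\<close> is allowed. Values lie in
  \<^typ>\<open>ereal\<close>, so that the upper limit and the supremum over a set below always exist; the
  derivative at a point near which \<open>f\<close> is Lipschitz is finite.\<close>

definition clarke_deriv :: "('a::real_normed_vector \<Rightarrow> real) \<Rightarrow> 'a \<Rightarrow> 'a \<Rightarrow> ereal" where
  "clarke_deriv f x h =
     Limsup (nhds x \<times>\<^sub>F at_right 0) (\<lambda>(y, t). ereal ((f (y + t *\<^sub>R h) - f y) / t))"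

definition clarke_gradient ::
    "('a::real_normed_vector \<Rightarrow> real) \<Rightarrow> 'a \<Rightarrow> ('a \<Rightarrow>\<^sub>L real) set" where
  "clarke_gradient f x = {a. \<forall>h. ereal (blinfun_apply a h) \<le> clarke_deriv f x h}"

text \<open>The topology of pointwise convergence on the dual space: for functionals, the weak* topology
  is the strong operator topology.\<close>

definition weak_star_topology :: "('a::real_normed_vector \<Rightarrow>\<^sub>L real) topology" where
  "weak_star_topology = strong_operator_topology"

definition clarke_gradient_on ::
    "('a::real_normed_vector \<Rightarrow> real) \<Rightarrow> 'a set \<Rightarrow> ('a \<Rightarrow>\<^sub>L real) set" where
  "clarke_gradient_on f A =
     weak_star_topology closure_of (convex hull (\<Union>y\<in>A. clarke_gradient f y))"

definition clarke_deriv_on ::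
    "('a::real_normed_vector \<Rightarrow> real) \<Rightarrow> 'a set \<Rightarrow> 'a \<Rightarrow> ereal" where
  "clarke_deriv_on f A h = (SUP y\<in>A. clarke_deriv f y h)"

end

theory Submission imports Defs begin

text \<open>A direction \<open>h\<close> with \<open>f\<^sup>0(x;h) < 0\<close> witnesses \<open>0 \<notin> \<partial>f(x)\<close>, and \<open>f\<^sup>0(\<cdot>;h) < 0\<close> is an
  open condition: the upper limit bounds the difference quotients by some \<open>c < 0\<close> uniformly
  on a ball, hence \<open>f\<^sup>0(y;h) \<le> c\<close> there. The half space \<open>{a. \<langle>a,h\<rangle> \<le> f\<^sup>0(A;h)}\<close> is convex and
  weak* closed, so it contains \<open>\<partial>f(A)\<close>.\<close>

text \<open>All difference quotients vanish, and the product filter is nontrivial, so the upper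
  limit of this constant is the constant itself. This later excludes the zero vector as a descent
  direction, so that the direction can be normalized.\<close>

lemma clarke_deriv_zero_direction: "clarke_deriv f x 0 = 0"
  unfolding clarke_deriv_def
  by (simp add: case_prod_unfold Limsup_const prod_filter_eq_bot trivial_limit_at_right_real
      flip: zero_ereal_def)

lemma clarke_deriv_less_imp_uniform:
  assumes "clarke_deriv f x h < ereal c"
  obtains \<epsilon> \<delta> where "\<epsilon> > 0" "\<delta> > 0"
    "\<And>y t. y \<in> ball x \<epsilon> \<Longrightarrow> 0 < t \<Longrightarrow> t < \<delta> \<Longrightarrow> (f (y + t *\<^sub>R h) - f y) / t < c"
proof -
  from Limsup_lessD[OF assms[unfolded clarke_deriv_def]]
  obtain P Q where P: "eventually P (nhds x)" and Q: "eventually Q (at_right 0)"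
    and PQ: "\<And>y t. P y \<Longrightarrow> Q t \<Longrightarrow> (f (y + t *\<^sub>R h) - f y) / t < c"
    unfolding eventually_prod_filter by auto
  obtain \<epsilon> where "\<epsilon> > 0" "\<And>y. dist y x < \<epsilon> \<Longrightarrow> P y"
    using P unfolding eventually_nhds_metric by auto
  moreover obtain \<delta> where "\<delta> > 0" "\<And>t. 0 < t \<Longrightarrow> t < \<delta> \<Longrightarrow> Q t"
    using Q unfolding eventually_at_right_field by auto
  ultimately show ?thesis
    using PQ by (intro that[of \<epsilon> \<delta>]) (auto simp: dist_commute)
qed

text \<open>A bound on the quotients over an open ball passes to the derivative at every point
  \<open>y\<close> of the ball, since the ball is also a neighbourhood of \<open>y\<close>.\<close>

lemma clarke_deriv_le:
  assumes "\<delta> > 0" "y \<in> ball x \<epsilon>"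
    and bound: "\<And>y t. y \<in> ball x \<epsilon> \<Longrightarrow> 0 < t \<Longrightarrow> t < \<delta> \<Longrightarrow> (f (y + t *\<^sub>R h) - f y) / t \<le> c"
  shows "clarke_deriv f y h \<le> ereal c"
  unfolding clarke_deriv_def
proof (rule Limsup_bounded)
  have "eventually (\<lambda>z. z \<in> ball x \<epsilon>) (nhds y)"
    using assms(2) by (intro eventually_nhds_in_open) auto
  moreover have "eventually (\<lambda>t. 0 < t \<and> t < \<delta>) (at_right (0::real))"
    using assms(1) by (auto simp: eventually_at_right_field)
  ultimately show "\<forall>\<^sub>F z in nhds y \<times>\<^sub>F at_right 0.
      (case z of (y, t) \<Rightarrow> ereal ((f (y + t *\<^sub>R h) - f y) / t)) \<le> ereal c"
    unfolding eventually_prod_filter using bound by fastforce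
qed

lemma clarke_deriv_negative_near:
  assumes "0 \<notin> clarke_gradient f x"
  obtains \<epsilon> h c where "\<epsilon> > 0" "norm h = 1" "c < 0"
    "\<And>y. y \<in> ball x \<epsilon> \<Longrightarrow> clarke_deriv f y h \<le> ereal c"
proof -
  from assms obtain v where v: "clarke_deriv f x v < 0"
    by (auto simp: clarke_gradient_def not_le zero_ereal_def)
  then have "v \<noteq> 0"
    by (auto simp: clarke_deriv_zero_direction)
  \<comment> \<open>A real number strictly between the derivative and 0: the gap below
    \<open>c\<close> makes the bound stable near \<open>x\<close>, the gap above it keeps later
    suprema away from 0.\<close>
  obtain c where c: "clarke_deriv f x v < ereal c" "c < 0"
    using ereal_dense2[OF v] by auto
  obtain \<epsilon> \<delta> where ed: "\<epsilon> > 0" "\<delta> > 0"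
    and bound: "\<And>y t. y \<in> ball x \<epsilon> \<Longrightarrow> 0 < t \<Longrightarrow> t < \<delta> \<Longrightarrow> (f (y + t *\<^sub>R v) - f y) / t < c"
    using clarke_deriv_less_imp_uniform[OF c(1)] by metis
  define h where "h = v /\<^sub>R norm v"
  \<comment> \<open>A step \<open>t\<close> along \<open>h\<close> is a step
    \<open>t / norm v\<close> along \<open>v\<close>. The quotient along \<open>h\<close> is
    therefore the one along \<open>v\<close> divided by \<open>norm v\<close>, which rescales both
    the bound \<open>c\<close> and the range of \<open>t\<close>.\<close>
  have scaled: "(f (y + t *\<^sub>R h) - f y) / t \<le> c / norm v"
    if "y \<in> ball x \<epsilon>" "0 < t" "t < \<delta> * norm v" for y t
  proof -
    have "(f (y + (t / norm v) *\<^sub>R v) - f y) / (t / norm v) < c"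
      using that \<open>v \<noteq> 0\<close> by (intro bound) (auto simp: field_simps)
    then show ?thesis
      using that \<open>v \<noteq> 0\<close> by (simp add: h_def field_simps)
  qed
  show ?thesis
  proof (rule that)
    show "norm h = 1" "c / norm v < 0"
      using \<open>v \<noteq> 0\<close> c(2) by (auto simp: h_def divide_neg_pos)
    show "clarke_deriv f y h \<le> ereal (c / norm v)" if "y \<in> ball x \<epsilon>" for y
      using that scaled ed(2) \<open>v \<noteq> 0\<close>
      by (intro clarke_deriv_le[where \<delta> = "\<delta> * norm v" and \<epsilon> = \<epsilon> and x = x]) auto
  qed (use ed in auto)
qed

lemma closed_real_le_ereal: "closed {r. ereal r \<le> M}"
  by (intro closed_Collect_le continuous_intros)

text \<open>DUMMY\<close>

lemma convex_blinfun_halfspace: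
  fixes h :: "'a::real_normed_vector"
  shows "convex {a :: 'a \<Rightarrow>\<^sub>L real. ereal (blinfun_apply a h) \<le> M}"
proof (cases M)
  case (real r)
  have "convex ((\<lambda>a :: 'a \<Rightarrow>\<^sub>L real. blinfun_apply a h) -` {..r})"
    by (intro convex_linear_vimage bounded_linear.linear bounded_linear_intros convex_real_interval)
  then show ?thesis
    by (simp add: real vimage_def)
qed auto

lemma closedin_weak_star_halfspace:
  "closedin weak_star_topology {a. ereal (blinfun_apply a h) \<le> M}"
proof -
  have "closedin weak_star_topology
      {a \<in> topspace weak_star_topology. blinfun_apply a h \<in> {r. ereal r \<le> M}}"
    unfolding weak_star_topology_def
    using strong_operator_topology_continuous_evaluation closed_real_le_ereal
    by (intro closedin_continuous_map_preimage[where Y = euclidean]) auto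
  then show ?thesis
    by (simp add: weak_star_topology_def strong_operator_topology_topspace)
qed

lemma clarke_gradient_on_le_deriv_on:
  assumes "a \<in> clarke_gradient_on f A"
  shows "ereal (blinfun_apply a h) \<le> clarke_deriv_on f A h"
proof -
  let ?H = "{a. ereal (blinfun_apply a h) \<le> clarke_deriv_on f A h}"
  have "(\<Union>y\<in>A. clarke_gradient f y) \<subseteq> ?H"
    by (auto simp: clarke_gradient_def clarke_deriv_on_def intro: SUP_upper2)
  then have "convex hull (\<Union>y\<in>A. clarke_gradient f y) \<subseteq> ?H"
    by (intro hull_minimal convex_blinfun_halfspace)
  then have "clarke_gradient_on f A \<subseteq> ?H"
    unfolding clarke_gradient_on_def
    by (intro closure_of_minimal closedin_weak_star_halfspace)
  with assms show ?thesis by auto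
qed

theorem proposition2p16:
  fixes f :: "'a::banach \<Rightarrow> real" and x :: 'a
  assumes "locally_lipschitz f"
    and "0 \<notin> clarke_gradient f x"
  shows "\<exists>\<epsilon>>0. \<exists>h. norm h = 1 \<and>
    (\<forall>A a. A \<noteq> {} \<and> A \<subseteq> ball x \<epsilon> \<and> a \<in> clarke_gradient_on f A \<longrightarrow>
       - norm a \<le> blinfun_apply a h \<and>
       ereal (blinfun_apply a h) \<le> clarke_deriv_on f A h \<and>
       clarke_deriv_on f A h < 0)"
proof -
  obtain \<epsilon> h c where "\<epsilon> > 0" and h: "norm h = 1" and "c < 0"
    and le: "\<And>y. y \<in> ball x \<epsilon> \<Longrightarrow> clarke_deriv f y h \<le> ereal c"
    using clarke_deriv_negative_near[OF assms(2)] by metis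
  have "- norm a \<le> blinfun_apply a h" for a :: "'a \<Rightarrow>\<^sub>L real"
    using norm_blinfun[of a h] h by simp
  moreover have "clarke_deriv_on f A h < 0" if "A \<subseteq> ball x \<epsilon>" for A
  proof -
    have "clarke_deriv_on f A h \<le> ereal c"
      using that le unfolding clarke_deriv_on_def by (intro SUP_least) auto
    also have "\<dots> < 0"
      using \<open>c < 0\<close> by simp
    finally show ?thesis .
  qed
  ultimately show ?thesis
    using \<open>\<epsilon> > 0\<close> h clarke_gradient_on_le_deriv_on by blast
qed

end
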